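(* Let $A\in\mathbb{R}^{m\times n}$ be nonzero and $b\in\mathbb{R}^m$. Let $\mathcal{D}$ be a distribution of random matrix quadruples $(S_1,S_2,T_1,T_2)$ satisfying $\mathbb{E}[T_1T_2^\top A^\top S_1S_2^\top]=\frac{A^\top}{\|A\|_F^2}$. Let $x_{LS}^*=A^\dagger b$, let $x^1=x^0\in\mathbb{R}^n$ be (deterministic) initial vectors, and let $\{x^k\}$ be generated by the mPFR iteration $$x^{k+1}=x^{k}-\alpha T_1T_2^\top A^\top S_1S_2^\top(Ax^{k}-b)+\omega(x^k-x^{k-1}),\qquad k\ge 1,$$ where at each iteration a fresh quadruple $(S_1,S_2,T_1,T_2)$ is drawn independently from $\mathcal{D}$. Denote $r^*=Ax_{LS}^*-b$, $r^k=Ax^k-b$, and $$\beta=\big\|\mathbb{E}[ S_2S_1^\top AT_2T_1^\top A^\top A T_1T_2^\top A^\top S_1S_2^\top ]\big\|_2.$$ Suppose that every quadruple $(S_1,S_2,T_1,T_2)$ sampled from $\mathcal{D}$ satisfies $T_1T_2^\top A^\top S_1 S_2^\top r^*=0$. Assume $0<\alpha<\frac{2\sigma^2_{\min}(A)}{\beta\|A\|^2_F}$, $\omega\geq0$, and that the expressions $$\gamma_1=1+3\omega+2\omega^2-(2\alpha+\alpha\omega)\frac{\sigma^2_{\min}(A)}{\|A\|^2_F}+\alpha^2\beta\quad\text{and}\quad\gamma_2=2\omega^2+\omega+\omega\alpha\frac{\sigma^2_{\max}(A)}{\|A\|^2_F}$$ satisfy $\gamma_1+\gamma_2<1$. Then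 $$\mathbb{E}[\|r^{k+1}-r^*\|^2_2]\leq q^k(1+\tau)\|r^0-r^*\|^2_2\qquad\text{for all } k\geq 0,$$ where $q=\frac{\gamma_1+\sqrt{\gamma_1^2+4\gamma_2}}{2}$ if $\omega>0$, $q=\gamma_1$ if $\omega=0$, and $\tau=q-\gamma_1\geq 0$. Moreover, $\gamma_1+\gamma_2\leq q<1$.
   Context: $A^\dagger$ is the Moore-Penrose pseudoinverse; $\|\cdot\|_F$ is the Frobenius norm; $\|\cdot\|_2$ is the Euclidean norm of a vector or the spectral norm of a matrix; $\sigma_{\max}(A)$ is the largest singular value and $\sigma_{\min}(A)$ the smallest nonzero singular value of $A$. $A$ may have any rank. The random matrices have sizes $S_1,S_2\in\mathbb{R}^{m\times p}$ and $T_1,T_2\in\mathbb{R}^{n\times s}$, where $p,s$ may themselves be random; the four matrices in a quadruple need not be independent of each other, but quadruples used at different iterations are independent and identically distributed. All expectations appearing are assumed to exist and be finite. *)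

theory Defs
  imports "HOL-Probability.Probability"
begin

text \<open>Matrices of fixed size m x n are of type \<open>real^'n^'m\<close>. The norm of that type is the Frobenius
  norm, see \<open>frobenius_norm_eq\<close>; the spectral norm of B is \<open>onorm ((*v) B)\<close>.\<close>

abbreviation frobenius_norm :: "real^'n^'m \<Rightarrow> real" where
  "frobenius_norm A \<equiv> norm A"

lemma frobenius_norm_eq:
  fixes A :: "real^'n^'m"
  shows "frobenius_norm A = sqrt (\<Sum>i\<in>UNIV. \<Sum>j\<in>UNIV. (A $ i $ j)\<^sup>2)"
  by (simp add: norm_vec_def L2_set_def sum_nonneg)

abbreviation spectral_norm :: "real^'n^'m \<Rightarrow> real" where
  "spectral_norm B \<equiv> onorm ((*v) B)"

definition pseudoinverse :: "real^'n^'m \<Rightarrow> real^'m^'n" where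
  "pseudoinverse A = (THE X. A ** X ** A = A \<and> X ** A ** X = X \<and>
     transpose (A ** X) = A ** X \<and> transpose (X ** A) = X ** A)"

text \<open>The square roots of the eigenvalues of the Gram matrix. If n > m, this set contains 0 even when
  A has full row rank; \<open>sigma_min\<close> excludes 0, and \<open>sigma_max\<close> is not affected.\<close>

definition singular_values :: "real^'n^'m \<Rightarrow> real set" where
  "singular_values A = {sqrt \<mu> | \<mu>. \<exists>v. v \<noteq> 0 \<and> (transpose A ** A) *v v = \<mu> *\<^sub>R v}"

definition sigma_max :: "real^'n^'m \<Rightarrow> real" where
  "sigma_max A = Max (singular_values A)"

definition sigma_min :: "real^'n^'m \<Rightarrow> real" where
  "sigma_min A = Min (singular_values A - {0})"

text \<open>The sampled matrices have a random number of columns, so the column count cannot be a type.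
  A matrix with m rows and an arbitrary number p of columns is the list, of length p, of its columns.
  The sigma-algebra is the one generated by the column count and the entries.\<close>

type_synonym 'm colmat = "(real^'m) list"

definition colmat_space :: "'m::finite colmat measure" where
  "colmat_space =
     vimage_algebra UNIV (\<lambda>S. (length S, \<lambda>l. if l < length S then S ! l else 0)) borel"

text \<open>\<open>mul_transpose S S'\<close> is the square matrix \<open>S S'\<^sup>T\<close>, for S and S' with equally many columns.\<close>

definition mul_transpose :: "'m colmat \<Rightarrow> 'm colmat \<Rightarrow> real^'m^'m" where
  "mul_transpose S S' = (\<chi> i j. \<Sum>l<length S. (S ! l) $ i * (S' ! l) $ j)"

text \<open>Quadruples \<open>(S\<^sub>1, S\<^sub>2, T\<^sub>1, T\<^sub>2)\<close> with \<open>S\<^sub>1\<close>, \<open>S\<^sub>2\<close> of a common size m x p and \<open>T\<^sub>1\<close>, \<open>T\<^sub>2\<close> of a common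
  size n x s.\<close>

type_synonym ('m, 'n) quadruple = "'m colmat \<times> 'm colmat \<times> 'n colmat \<times> 'n colmat"

definition quadruple_space :: "('m::finite, 'n::finite) quadruple measure" where
  "quadruple_space =
     restrict_space (colmat_space \<Otimes>\<^sub>M colmat_space \<Otimes>\<^sub>M colmat_space \<Otimes>\<^sub>M colmat_space)
       {(S1, S2, T1, T2). length S1 = length S2 \<and> length T1 = length T2}"

text \<open>\<open>T\<^sub>1 T\<^sub>2\<^sup>T A\<^sup>T S\<^sub>1 S\<^sub>2\<^sup>T\<close>\<close>

definition mpfr_matrix :: "real^'n^'m \<Rightarrow> ('m, 'n) quadruple \<Rightarrow> real^'m^'n" where
  "mpfr_matrix A = (\<lambda>(S1, S2, T1, T2).
     mul_transpose T1 T2 ** transpose A ** mul_transpose S1 S2)"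

text \<open>\<open>S\<^sub>2 S\<^sub>1\<^sup>T A T\<^sub>2 T\<^sub>1\<^sup>T A\<^sup>T A T\<^sub>1 T\<^sub>2\<^sup>T A\<^sup>T S\<^sub>1 S\<^sub>2\<^sup>T\<close>\<close>

definition mpfr_gram :: "real^'n^'m \<Rightarrow> ('m, 'n) quadruple \<Rightarrow> real^'m^'m" where
  "mpfr_gram A = (\<lambda>(S1, S2, T1, T2).
     mul_transpose S2 S1 ** A ** mul_transpose T2 T1 ** transpose A ** A **
     mul_transpose T1 T2 ** transpose A ** mul_transpose S1 S2)"

end

theory Submission imports Defs begin

text \<open>
  The error \<open>y k = r k - r\<^sub>s\<close> lies in the range of A, and since the sampled matrix annihilates
  \<open>r\<^sub>s\<close> it obeys the homogeneous momentum recursion. Conditionally on the past, expanding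
  \<open>\<parallel>y (k + 1)\<parallel>\<^sup>2\<close> leaves only the means of \<open>mpfr_matrix\<close> and \<open>mpfr_gram\<close>; on the range of A the form
  \<open>\<parallel>A\<^sup>T y\<parallel>\<^sup>2\<close> lies between \<open>\<sigma>\<^sub>m\<^sub>i\<^sub>n\<^sup>2 \<parallel>y\<parallel>\<^sup>2\<close> and \<open>\<sigma>\<^sub>m\<^sub>a\<^sub>x\<^sup>2 \<parallel>y\<parallel>\<^sup>2\<close>. This gives the scalar recursion
  \<open>F (k + 2) \<le> \<gamma>\<^sub>1 F (k + 1) + \<gamma>\<^sub>2 F k\<close>, for which \<open>F (k + 1) + \<tau> F k\<close> contracts with factor q, the larger
  root of \<open>q\<^sup>2 = \<gamma>\<^sub>1 q + \<gamma>\<^sub>2\<close>.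
\<close>

section \<open>Self-adjoint operators and extreme singular values\<close>

lemma inner_transpose_vector:
  fixes A :: "real^'n^'m"
  shows "x \<bullet> (transpose A *v y) = (A *v x) \<bullet> y"
  by (metis dot_lmul_matrix inner_commute transpose_matrix_vector)

text \<open>Eigenvectors to distinct eigenvalues are orthogonal, so one eigenvector per eigenvalue
  gives an independent, hence finite, set. Finiteness is what gives the \<open>Min\<close> and
  \<open>Max\<close> in \<open>sigma_min\<close> and \<open>sigma_max\<close> their meaning.\<close>

lemma finite_eigenvalues_selfadjoint:
  fixes f :: "'a::euclidean_space \<Rightarrow> 'a"
  assumes adj: "\<And>x y. f x \<bullet> y = x \<bullet> f y"
  shows "finite {\<mu>. \<exists>v. v \<noteq> 0 \<and> f v = \<mu> *\<^sub>R v}"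
proof -
  let ?E = "{\<mu>. \<exists>v. v \<noteq> 0 \<and> f v = \<mu> *\<^sub>R v}"
  define e where "e \<mu> = (SOME v. v \<noteq> 0 \<and> f v = \<mu> *\<^sub>R v)" for \<mu>
  have e: "e \<mu> \<noteq> 0 \<and> f (e \<mu>) = \<mu> *\<^sub>R e \<mu>" if "\<mu> \<in> ?E" for \<mu>
    unfolding e_def using that by - (rule someI_ex, blast)
  have orth: "e \<mu> \<bullet> e \<nu> = 0" if "\<mu> \<in> ?E" "\<nu> \<in> ?E" "\<mu> \<noteq> \<nu>" for \<mu> \<nu>
    using adj[of "e \<mu>" "e \<nu>"] e[OF that(1)] e[OF that(2)] that(3) by simp
  have "inj_on e ?E"
    using e orth by (metis (no_types, lifting) inj_onI inner_eq_zero_iff)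
  moreover have ne: "0 \<notin> e ` ?E"
    using e by fastforce
  have "pairwise orthogonal (e ` ?E)"
    using orth by (auto simp: pairwise_def orthogonal_def)
  then have "independent (e ` ?E)"
    using ne by (rule pairwise_orthogonal_independent)
  ultimately show ?thesis
    using independent_imp_finite finite_imageD by blast
qed

text \<open>First variation: from a zero \<open>v0\<close> of the form, a step t along the residual
  \<open>w = f v0 - \<mu> v0\<close> changes it to first order by
  \<open>2 * t * (w \<bullet> w)\<close>. A nonzero residual would make the form negative for small
  negative t.\<close>

lemma selfadjoint_minimizer_eigenvector:
  fixes f :: "'a::euclidean_space \<Rightarrow> 'a"
  assumes lin: "linear f" and adj: "\<And>x y. f x \<bullet> y = x \<bullet> f y"
    and V: "subspace V" and inv: "\<And>v. v \<in> V \<Longrightarrow> f v \<in> V"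
    and lower: "\<And>v. v \<in> V \<Longrightarrow> \<mu> * (norm v)\<^sup>2 \<le> v \<bullet> f v"
    and v0: "v0 \<in> V" "v0 \<bullet> f v0 = \<mu> * (norm v0)\<^sup>2"
  shows "f v0 = \<mu> *\<^sub>R v0"
proof (rule ccontr)
  assume ne: "f v0 \<noteq> \<mu> *\<^sub>R v0"
  define w where "w = f v0 - \<mu> *\<^sub>R v0"
  define c where "c = w \<bullet> f w - \<mu> * (norm w)\<^sup>2"
  have w: "w \<in> V" unfolding w_def using V inv v0 by (simp add: subspace_diff subspace_scale)
  have c: "0 \<le> c" using lower[OF w] by (simp add: c_def)
  have pos: "0 < w \<bullet> w" using ne by (simp add: w_def)
  \<comment> \<open>The form \<open>x \<bullet> f x - \<mu> \<parallel>x\<parallel>\<^sup>2\<close>, nonnegative on V, along the line \<open>v0 + t w\<close>.\<close>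
  have quad: "0 \<le> 2 * t * (w \<bullet> w) + t\<^sup>2 * c" for t
  proof -
    have "v0 + t *\<^sub>R w \<in> V" using V w v0 by (simp add: subspace_add subspace_scale)
    moreover have "(norm (v0 + t *\<^sub>R w))\<^sup>2 = (norm v0)\<^sup>2 + 2 * t * (v0 \<bullet> w) + t\<^sup>2 * (norm w)\<^sup>2"
      by (simp only: power2_norm_eq_inner) (simp add: inner_simps algebra_simps power2_eq_square inner_commute)
    ultimately have "\<mu> * ((norm v0)\<^sup>2 + 2 * t * (v0 \<bullet> w) + t\<^sup>2 * (norm w)\<^sup>2)
        \<le> (v0 + t *\<^sub>R w) \<bullet> f (v0 + t *\<^sub>R w)"
      using lower by metis
    with v0(2) have "0 \<le> 2 * t * (w \<bullet> f v0 - \<mu> * (w \<bullet> v0)) + t\<^sup>2 * c"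
      using adj[of v0 w]
      by (simp add: linear_add[OF lin] linear_cmul[OF lin] inner_simps
          c_def algebra_simps power2_eq_square inner_commute)
    moreover have "w \<bullet> f v0 - \<mu> * (w \<bullet> v0) = w \<bullet> w"
      by (simp add: w_def inner_simps)
    ultimately show ?thesis by simp
  qed
  \<comment> \<open>The choice \<open>t = - (w \<bullet> w) / c\<close> would minimize the
    quadratic, but \<open>c\<close> may be 0; with \<open>d = c + 1\<close> the division is safe and
    the value is still negative.\<close>
  define d where "d = c + 1"
  have d: "0 < d" "c = d - 1" using c by (auto simp: d_def)
  let ?t = "- (w \<bullet> w) / d"
  have "2 * ?t * (w \<bullet> w) + ?t\<^sup>2 * c = (w \<bullet> w)\<^sup>2 / d\<^sup>2 * (- d - 1)"
    using d(1) unfolding d(2) by (simp add: field_simps power2_eq_square)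
  also have "\<dots> < 0" using pos d(1) by (intro mult_pos_neg) auto
  finally show False using quad[of ?t] by simp
qed

text \<open>The Rayleigh quotient attains its minimum on the compact unit sphere of V, and
  homogeneity carries the bound to all of V. The invariant subspace is there so that V can be the
  range of A, which leaves the zero eigenvalue out.\<close>

lemma selfadjoint_minimal_eigenvector:
  fixes f :: "'a::euclidean_space \<Rightarrow> 'a"
  assumes lin: "linear f" and adj: "\<And>x y. f x \<bullet> y = x \<bullet> f y"
    and V: "subspace V" and inv: "\<And>v. v \<in> V \<Longrightarrow> f v \<in> V" and u: "u \<in> V" "u \<noteq> 0"
  shows "\<exists>\<mu>. \<exists>v\<in>V. v \<noteq> 0 \<and> f v = \<mu> *\<^sub>R v \<and> (\<forall>x\<in>V. \<mu> * (norm x)\<^sup>2 \<le> x \<bullet> f x)"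
proof -
  let ?K = "sphere 0 1 \<inter> V"
  have "compact ?K" using V by (intro compact_Int_closed closed_subspace) auto
  moreover have "u /\<^sub>R norm u \<in> ?K" using u V by (auto simp: subspace_scale)
  moreover have "continuous_on ?K (\<lambda>x. x \<bullet> f x)"
    using lin by (intro continuous_intros linear_continuous_on linear_linear[THEN iffD1])
      (simp add: linear_conv_bounded_linear)
  ultimately obtain v where v: "v \<in> ?K" and least: "\<And>x. x \<in> ?K \<Longrightarrow> v \<bullet> f v \<le> x \<bullet> f x"
    using continuous_attains_inf[of ?K "\<lambda>x. x \<bullet> f x"] by blast
  define \<mu> where "\<mu> = v \<bullet> f v"
  have lower: "\<mu> * (norm x)\<^sup>2 \<le> x \<bullet> f x" if "x \<in> V" for x
  proof (cases "x = 0")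
    case False
    then have "x /\<^sub>R norm x \<in> ?K" using that V by (auto simp: subspace_scale)
    from least[OF this] False show ?thesis
      by (simp add: \<mu>_def linear_cmul[OF lin] field_simps power2_eq_square)
  qed simp
  have "f v = \<mu> *\<^sub>R v"
    using v by (intro selfadjoint_minimizer_eigenvector[OF lin adj V inv lower]) (auto simp: \<mu>_def)
  then show ?thesis using lower v by (intro exI[of _ \<mu>] bexI[of _ v]) auto
qed

lemma finite_singular_values: "finite (singular_values A)"
proof -
  let ?f = "(*v) (transpose A ** A)"
  have "finite {\<mu>. \<exists>v. v \<noteq> 0 \<and> ?f v = \<mu> *\<^sub>R v}"
    by (intro finite_eigenvalues_selfadjoint)
      (metis inner_transpose_vector inner_commute matrix_vector_mul_assoc)
  moreover have "singular_values A = sqrt ` {\<mu>. \<exists>v. v \<noteq> 0 \<and> ?f v = \<mu> *\<^sub>R v}"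
    by (auto simp: singular_values_def)
  ultimately show ?thesis by simp
qed

text \<open>Since \<open>sqrt\<close> of a negative real is negative, this rests on the eigenvalues
  of the Gram matrix being nonnegative: \<open>\<mu> * (v \<bullet> v)\<close> is the squared norm
  of \<open>A *v v\<close>.\<close>

lemma singular_values_nonneg:
  assumes "s \<in> singular_values A"
  shows "0 \<le> s"
proof -
  obtain \<mu> v where s: "s = sqrt \<mu>" and v: "v \<noteq> 0" "(transpose A ** A) *v v = \<mu> *\<^sub>R v"
    using assms by (auto simp: singular_values_def)
  have "\<mu> * (v \<bullet> v) = (A *v v) \<bullet> (A *v v)"
    using v(2) inner_transpose_vector[of v A "A *v v"] by (simp add: matrix_vector_mul_assoc)
  also have "\<dots> \<ge> 0" by simp
  finally show ?thesis using v(1) s inner_gt_zero_iff[of v] by (auto simp: zero_le_mult_iff simp del: inner_gt_zero_iff)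
qed

text \<open>\<open>transpose A\<close> maps an eigenvector of \<open>A ** transpose A\<close> with
  nonzero eigenvalue to one of \<open>transpose A ** A\<close>. The latter matrix defines the
  singular values; the former leaves the range of A invariant.\<close>

lemma sqrt_eigenvalue_singular_value:
  fixes A :: "real^'n^'m"
  assumes "A *v (transpose A *v y) = \<mu> *\<^sub>R y" "y \<noteq> 0" "\<mu> \<noteq> 0"
  shows "sqrt \<mu> \<in> singular_values A - {0}"
proof -
  have "transpose A *v y \<noteq> 0" using assms by auto
  moreover have "(transpose A ** A) *v (transpose A *v y) = \<mu> *\<^sub>R (transpose A *v y)"
    by (metis assms(1) matrix_vector_mul_assoc matrix_vector_mult_scaleR)
  ultimately show ?thesis using assms(3) by (auto simp: singular_values_def)
qed

text \<open>The kernel of \<open>transpose A\<close> is the orthogonal complement of the range of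
  A.\<close>

lemma transpose_vector_nonzero_on_range:
  fixes A :: "real^'n^'m"
  assumes "y \<in> range ((*v) A)" "y \<noteq> 0"
  shows "transpose A *v y \<noteq> 0"
  using assms inner_transpose_vector[of _ A y] by (metis imageE inner_eq_zero_iff inner_zero_right)

text \<open>Rayleigh bounds for \<open>A ** transpose A\<close> restricted to the range of A. All
  its eigenvalues there are positive, so the extreme ones are squares of nonzero singular values,
  whatever the rank of A.\<close>

lemma
  fixes A :: "real^'n^'m"
  assumes y: "y \<in> range ((*v) A)"
  shows sigma_min_le_on_range: "(sigma_min A)\<^sup>2 * (norm y)\<^sup>2 \<le> (norm (transpose A *v y))\<^sup>2"
    and sigma_max_ge_on_range: "(norm (transpose A *v y))\<^sup>2 \<le> (sigma_max A)\<^sup>2 * (norm y)\<^sup>2"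
proof -
  let ?V = "range ((*v) A)" and ?f = "\<lambda>y. A *v (transpose A *v y)"
  have V: "subspace ?V" by (intro linear_subspace_image matrix_vector_mul_linear subspace_UNIV)
  have lin: "linear ?f"
    by (simp only: matrix_vector_mul_assoc matrix_vector_mul_linear)
  have gram: "u \<bullet> ?f u = (norm (transpose A *v u))\<^sup>2" for u
    using inner_transpose_vector[of "transpose A *v u" A u]
    by (simp add: power2_norm_eq_inner inner_commute)
  have adj: "?f u \<bullet> v = u \<bullet> ?f v" for u v
    by (metis inner_commute inner_transpose_vector)
  have inv: "?f v \<in> ?V" for v by simp
  have ev: "\<mu> > 0" if "v \<in> ?V" "v \<noteq> 0" "?f v = \<mu> *\<^sub>R v" for v \<mu>
  proof -
    have "\<mu> * (norm v)\<^sup>2 = (norm (transpose A *v v))\<^sup>2"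
      using gram[of v] that(3) by (simp add: power2_norm_eq_inner)
    also have "\<dots> > 0" using transpose_vector_nonzero_on_range[OF that(1,2)] by simp
    finally show ?thesis by (simp add: zero_less_mult_iff)
  qed
  show "(sigma_min A)\<^sup>2 * (norm y)\<^sup>2 \<le> (norm (transpose A *v y))\<^sup>2"
  proof (cases "y = 0")
    case False
    obtain \<mu> v where v: "v \<in> ?V" "v \<noteq> 0" "?f v = \<mu> *\<^sub>R v"
      and low: "\<And>x. x \<in> ?V \<Longrightarrow> \<mu> * (norm x)\<^sup>2 \<le> x \<bullet> ?f x"
      using selfadjoint_minimal_eigenvector[OF lin adj V inv y False] by blast
    have \<mu>: "\<mu> > 0" using ev[OF v] .
    then have s: "sqrt \<mu> \<in> singular_values A - {0}"
      using v by (intro sqrt_eigenvalue_singular_value) auto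
    have fin: "finite (singular_values A - {0})" using finite_singular_values by auto
    have "sigma_min A \<le> sqrt \<mu>" unfolding sigma_min_def using s fin by simp
    \<comment> \<open>Needed for squaring. The set of nonzero singular values contains
      \<open>sqrt \<mu>\<close>, so its \<open>Min\<close> is a member of it.\<close>
    moreover have "sigma_min A \<ge> 0" unfolding sigma_min_def
      using s fin Min_in[OF fin] singular_values_nonneg by (metis DiffD1 empty_iff)
    ultimately have "(sigma_min A)\<^sup>2 \<le> \<mu>"
      using \<mu> by (metis power_mono real_sqrt_pow2 less_imp_le)
    then have "(sigma_min A)\<^sup>2 * (norm y)\<^sup>2 \<le> \<mu> * (norm y)\<^sup>2" by (simp add: mult_right_mono)
    with low[OF y] gram[of y] show ?thesis by simp
  qed simp
  show "(norm (transpose A *v y))\<^sup>2 \<le> (sigma_max A)\<^sup>2 * (norm y)\<^sup>2"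
  proof (cases "y = 0")
    case False
    \<comment> \<open>The largest eigenvalue comes from the minimal one of the negated operator, so
      from here on \<open>- \<mu>\<close> is the eigenvalue in question.\<close>
    have lin': "linear (\<lambda>y. - ?f y)" using lin by (rule linear_compose_neg)
    have adj': "(- ?f u) \<bullet> v = u \<bullet> (- ?f v)" for u v using adj by simp
    have inv': "- ?f v \<in> ?V" for v using V by (simp add: subspace_neg)
    obtain \<mu> v where v: "v \<in> ?V" "v \<noteq> 0" "- ?f v = \<mu> *\<^sub>R v"
      and low: "\<And>x. x \<in> ?V \<Longrightarrow> \<mu> * (norm x)\<^sup>2 \<le> x \<bullet> (- ?f x)"
      using selfadjoint_minimal_eigenvector[OF lin' adj' V inv' y False] by blast
    have v': "?f v = (- \<mu>) *\<^sub>R v" using v(3) by (metis minus_equation_iff scaleR_minus_left)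
    have \<mu>: "- \<mu> > 0" using ev[OF v(1,2) v'] .
    then have s: "sqrt (- \<mu>) \<in> singular_values A - {0}"
      using v(2) v' by (intro sqrt_eigenvalue_singular_value) auto
    have "sqrt (- \<mu>) \<le> sigma_max A" unfolding sigma_max_def
      using s by (intro Max_ge finite_singular_values) auto
    then have "- \<mu> \<le> (sigma_max A)\<^sup>2" by (rule sqrt_le_D)
    then have "- \<mu> * (norm y)\<^sup>2 \<le> (sigma_max A)\<^sup>2 * (norm y)\<^sup>2" by (intro mult_right_mono) auto
    with low[OF y] gram[of y] show ?thesis by simp
  qed simp
qed

section \<open>Independence of the current state and the fresh sample\<close>

lemma (in prob_space) nn_integral_indep_var:
  assumes ind: "indep_var L X N Y" and f: "f \<in> borel_measurable (L \<Otimes>\<^sub>M N)"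
  shows "(\<integral>\<^sup>+w. f (X w, Y w) \<partial>M) = (\<integral>\<^sup>+w. (\<integral>\<^sup>+z. f (X w, z) \<partial>distr M N Y) \<partial>M)"
proof -
  have X[measurable]: "X \<in> measurable M L" and Y[measurable]: "Y \<in> measurable M N"
    and eq: "distr M L X \<Otimes>\<^sub>M distr M N Y = distr M (L \<Otimes>\<^sub>M N) (\<lambda>w. (X w, Y w))"
    using ind by (auto simp: indep_var_distribution_eq)
  interpret Y: prob_space "distr M N Y" using Y by (rule prob_space_distr)
  have f'[measurable]: "f \<in> borel_measurable (distr M L X \<Otimes>\<^sub>M distr M N Y)"
    using f by (simp add: eq)
  have f''[measurable]: "f \<in> borel_measurable (L \<Otimes>\<^sub>M distr M N Y)"
    using f by (simp cong: measurable_cong_sets)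
  \<comment> \<open>Tonelli on the product law. Nonnegative integrals let the identity be applied
    before any moment is known to be finite.\<close>
  have "(\<integral>\<^sup>+w. f (X w, Y w) \<partial>M) = integral\<^sup>N (distr M L X \<Otimes>\<^sub>M distr M N Y) f"
    unfolding eq using f by (subst nn_integral_distr) auto
  also have "\<dots> = (\<integral>\<^sup>+x. (\<integral>\<^sup>+z. f (x, z) \<partial>distr M N Y) \<partial>distr M L X)"
    using f' by (rule Y.nn_integral_fst[symmetric])
  also have "\<dots> = (\<integral>\<^sup>+w. (\<integral>\<^sup>+z. f (X w, z) \<partial>distr M N Y) \<partial>M)"
    using Y.borel_measurable_nn_integral_fst[OF f''] by (subst nn_integral_distr) auto
  finally show ?thesis .
qed

text \<open>The library's \<open>indep_var\<close> forces both variables into one value type, so the independence of the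
  state \<open>P k\<close> and the fresh input \<open>Q k\<close> is stated as a Fubini identity.\<close>

lemma (in prob_space) random_recursion_independent_input:
  fixes L :: "'b measure" and N :: "'c measure"
  assumes ind: "indep_vars (\<lambda>_. N) Q {1..}"
    and g: "(\<lambda>(p, z). g p z) \<in> measurable (L \<Otimes>\<^sub>M N) L" and c: "c \<in> space L"
    and init: "\<And>w. w \<in> space M \<Longrightarrow> P 1 w = c"
    and step: "\<And>k w. k \<ge> 1 \<Longrightarrow> w \<in> space M \<Longrightarrow> P (Suc k) w = g (P k w) (Q k w)"
    and k: "k \<ge> 1"
  shows "P k \<in> measurable M L"
    and "f \<in> borel_measurable (L \<Otimes>\<^sub>M N) \<Longrightarrow>
      (\<integral>\<^sup>+w. f (P k w, Q k w) \<partial>M) = (\<integral>\<^sup>+w. (\<integral>\<^sup>+z. f (P k w, z) \<partial>distr M N (Q k)) \<partial>M)"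
proof -
  \<comment> \<open>The state at time k is a measurable function of the inputs with index below k
    only; at k = 1 there are none and the state is constant.\<close>
  have "\<exists>h \<in> measurable (PiM {1..<k} (\<lambda>_. N)) L. \<forall>w\<in>space M. P k w = h (\<lambda>i\<in>{1..<k}. Q i w)"
    using k
  proof (induction k rule: nat_induct_at_least)
    case base
    show ?case using c init by (intro bexI[of _ "\<lambda>_. c"]) auto
  next
    case (Suc k)
    then obtain h where h: "h \<in> measurable (PiM {1..<k} (\<lambda>_. N)) L"
      and P: "\<And>w. w \<in> space M \<Longrightarrow> P k w = h (\<lambda>i\<in>{1..<k}. Q i w)" by blast
    let ?h = "\<lambda>s. (\<lambda>(p, z). g p z) (h (restrict s {1..<k}), s k)"
    have h': "?h \<in> measurable (PiM {1..<Suc k} (\<lambda>_. N)) L"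
      using Suc(1)
      by (intro measurable_compose[OF _ g] measurable_Pair measurable_compose[OF _ h]
          measurable_restrict_subset measurable_component_singleton) auto
    have "P (Suc k) w = ?h (\<lambda>i\<in>{1..<Suc k}. Q i w)" if "w \<in> space M" for w
    proof -
      have "{1..<Suc k} \<inter> {1..<k} = {1..<k}" by auto
      then show ?thesis using step[OF Suc(1) that] P[OF that] Suc(1) by (simp add: restrict_restrict)
    qed
    then show ?case by (intro bexI[OF _ h'] ballI)
  qed
  then obtain h where h: "h \<in> measurable (PiM {1..<k} (\<lambda>_. N)) L"
    and P: "\<And>w. w \<in> space M \<Longrightarrow> P k w = h (\<lambda>i\<in>{1..<k}. Q i w)" by blast
  \<comment> \<open>The fresh input is viewed as a function on the singleton \<open>{k}\<close>, so
    that past and present are two blocks of one independent family over disjoint index sets.\<close>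
  let ?U = "\<lambda>w. \<lambda>i\<in>{1..<k}. Q i w" and ?V = "\<lambda>w. \<lambda>i\<in>{k}. Q i w"
  have UV: "indep_var (PiM {1..<k} (\<lambda>_. N)) ?U (PiM {k} (\<lambda>_. N)) ?V"
    using k by (intro indep_var_restrict[OF ind]) auto
  note U = indep_var_rv1[OF UV] and V[measurable] = indep_var_rv2[OF UV]
  have Q[measurable]: "Q k \<in> measurable M N"
    using measurable_compose[OF V measurable_component_singleton[of k]] by simp
  have "(\<lambda>w. h (?U w)) \<in> measurable M L" using U h by (rule measurable_compose)
  then show "P k \<in> measurable M L" using P by (simp cong: measurable_cong)
  assume f: "f \<in> borel_measurable (L \<Otimes>\<^sub>M N)"
  have fh: "(\<lambda>(s, t). f (h s, t k)) \<in> borel_measurable (PiM {1..<k} (\<lambda>_. N) \<Otimes>\<^sub>M PiM {k} (\<lambda>_. N))"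
    unfolding case_prod_beta
    by (intro measurable_compose[OF measurable_Pair f] measurable_compose[OF measurable_fst h]
        measurable_compose[OF measurable_snd measurable_component_singleton]) simp
  have inner: "(\<integral>\<^sup>+t. f (h (?U w), t k) \<partial>distr M (PiM {k} (\<lambda>_. N)) ?V)
      = (\<integral>\<^sup>+z. f (P k w, z) \<partial>distr M N (Q k))" if w: "w \<in> space M" for w
  proof -
    have "h (?U w) \<in> space L" using measurable_space[OF h] measurable_space[OF U w] by blast
    then have fw: "(\<lambda>z. f (h (?U w), z)) \<in> borel_measurable N"
      using f by (rule measurable_Pair2[rotated])
    have "(\<lambda>t. f (h (?U w), t k)) \<in> borel_measurable (PiM {k} (\<lambda>_. N))"
      by (intro measurable_compose[OF _ fw] measurable_component_singleton) simp
    then show ?thesis using fw P[OF w] by (simp add: nn_integral_distr)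
  qed
  have "(\<integral>\<^sup>+w. f (P k w, Q k w) \<partial>M) = (\<integral>\<^sup>+w. (\<lambda>(s, t). f (h s, t k)) (?U w, ?V w) \<partial>M)"
    using P by (intro nn_integral_cong) simp
  also have "\<dots> = (\<integral>\<^sup>+w. (\<integral>\<^sup>+t. f (h (?U w), t k) \<partial>distr M (PiM {k} (\<lambda>_. N)) ?V) \<partial>M)"
    using nn_integral_indep_var[OF UV fh] by (simp only: prod.case)
  also have "\<dots> = (\<integral>\<^sup>+w. (\<integral>\<^sup>+z. f (P k w, z) \<partial>distr M N (Q k)) \<partial>M)"
    using inner by (intro nn_integral_cong)
  finally show "(\<integral>\<^sup>+w. f (P k w, Q k w) \<partial>M) = (\<integral>\<^sup>+w. (\<integral>\<^sup>+z. f (P k w, z) \<partial>distr M N (Q k)) \<partial>M)" .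
qed

section \<open>The scalar two-term recurrence\<close>

lemma momentum_recurrence_bound:
  fixes F :: "nat \<Rightarrow> real" and \<gamma>1 \<gamma>2 \<tau> q :: real
  assumes rec: "\<And>k. F (k + 2) \<le> \<gamma>1 * F (k + 1) + \<gamma>2 * F k"
    and nonneg: "\<And>k. 0 \<le> F k" and init: "F 1 = F 0"
    and q: "0 \<le> q" "0 \<le> \<tau>" "\<gamma>1 = q - \<tau>" "\<gamma>2 = q * \<tau>"
  shows "F (k + 1) \<le> q ^ k * (1 + \<tau>) * F 0"
proof -
  \<comment> \<open>Adding \<open>\<tau> * F k\<close> reduces the recurrence to first order:
    \<open>\<gamma>1 + \<tau> = q\<close> and \<open>\<gamma>2 = q * \<tau>\<close> turn the
    right-hand side into q times the previous sum. The factor \<open>1 + \<tau>\<close> comes from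
    \<open>F 1 = F 0\<close>.\<close>
  have "F (k + 1) + \<tau> * F k \<le> q ^ k * (1 + \<tau>) * F 0"
  proof (induction k)
    case 0
    then show ?case by (simp add: init[unfolded One_nat_def] algebra_simps)
  next
    case (Suc k)
    have "F (Suc k + 1) + \<tau> * F (Suc k) \<le> q * (F (k + 1) + \<tau> * F k)"
      using rec[of k] by (simp add: q algebra_simps)
    also have "\<dots> \<le> q * (q ^ k * (1 + \<tau>) * F 0)" using Suc q by (intro mult_left_mono)
    finally show ?case by (simp add: algebra_simps)
  qed
  moreover have "0 \<le> \<tau> * F k" using q nonneg by simp
  ultimately show ?thesis by linarith
qed

text \<open>With s the square root of the discriminant, the two bounds on q amount to
  \<open>\<gamma>1 + 2 * \<gamma>2 \<le> s\<close> and \<open>s < 2 - \<gamma>1\<close>; after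
  squaring, both follow from \<open>\<gamma>1 + \<gamma>2 < 1\<close>.\<close>

lemma momentum_root:
  fixes \<gamma>1 \<gamma>2 q :: real
  assumes "0 \<le> \<gamma>1" "0 \<le> \<gamma>2" "\<gamma>1 + \<gamma>2 < 1" and q: "q = (\<gamma>1 + sqrt (\<gamma>1\<^sup>2 + 4 * \<gamma>2)) / 2"
  shows "0 \<le> q" "\<gamma>1 \<le> q" "\<gamma>2 = q * (q - \<gamma>1)" "\<gamma>1 + \<gamma>2 \<le> q" "q < 1"
proof -
  define s where "s = sqrt (\<gamma>1\<^sup>2 + 4 * \<gamma>2)"
  have s2: "s\<^sup>2 = \<gamma>1\<^sup>2 + 4 * \<gamma>2" using assms by (simp add: s_def)
  have q': "q = (\<gamma>1 + s) / 2" by (simp add: q s_def)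
  have "\<gamma>1 \<le> s" unfolding s_def using assms by (intro real_le_rsqrt) auto
  then show 1: "\<gamma>1 \<le> q" and 0: "0 \<le> q" using assms q' by auto
  show eq: "\<gamma>2 = q * (q - \<gamma>1)" using s2 by (simp add: q' field_simps power2_eq_square)
  have "\<gamma>2 * (\<gamma>1 + \<gamma>2) \<le> \<gamma>2 * 1" using assms by (intro mult_left_mono) auto
  then have "(\<gamma>1 + 2 * \<gamma>2)\<^sup>2 \<le> s\<^sup>2"
    unfolding s2 by (simp add: power2_eq_square algebra_simps)
  then have "\<gamma>1 + 2 * \<gamma>2 \<le> s" using \<open>\<gamma>1 \<le> s\<close> assms by - (rule power2_le_imp_le, auto)
  then show "\<gamma>1 + \<gamma>2 \<le> q" by (simp add: q')
  have "s\<^sup>2 < (2 - \<gamma>1)\<^sup>2" unfolding s2 using assms by (simp add: power2_eq_square algebra_simps)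
  then have "s < 2 - \<gamma>1" using assms by - (rule power2_less_imp_less, auto)
  then show "q < 1" by (simp add: q')
qed

section \<open>The conditional second moment of one step\<close>

lemma mul_transpose_swap:
  assumes "length S = length S'"
  shows "transpose (mul_transpose S S') = mul_transpose S' S"
  using assms by (simp add: mul_transpose_def transpose_def vec_eq_iff mult.commute)

text \<open>\<open>mpfr_gram A Z\<close> is the Gram matrix of \<open>A ** mpfr_matrix A Z\<close>.
  The equal column counts matter: \<open>mul_transpose\<close> sums over the columns of its first
  argument, and transposition swaps the arguments.\<close>

lemma inner_mpfr_gram:
  fixes A :: "real^'n^'m"
  assumes "Z \<in> space quadruple_space"
  shows "u \<bullet> (mpfr_gram A Z *v u) = (norm (A *v (mpfr_matrix A Z *v u)))\<^sup>2"
proof -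
  obtain S1 S2 T1 T2 where Z: "Z = (S1, S2, T1, T2)"
    and len: "length S1 = length S2" "length T1 = length T2"
    using assms by (cases Z) (auto simp: quadruple_space_def space_restrict_space)
  have "mpfr_gram A Z = transpose (A ** mpfr_matrix A Z) ** (A ** mpfr_matrix A Z)"
    using len by (simp add: Z mpfr_gram_def mpfr_matrix_def matrix_transpose_mul mul_transpose_swap
        matrix_mul_assoc)
  then show ?thesis
    using inner_transpose_vector[of u "A ** mpfr_matrix A Z" "A ** mpfr_matrix A Z *v u"]
    by (simp only: power2_norm_eq_inner matrix_vector_mul_assoc)
qed

lemma borel_measurable_matrix_vector_mult [measurable (raw)]:
  fixes f :: "'a \<Rightarrow> real^'n^'m" and g :: "'a \<Rightarrow> real^'n"
  assumes "f \<in> borel_measurable M" "g \<in> borel_measurable M"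
  shows "(\<lambda>x. f x *v g x) \<in> borel_measurable M"
proof -
  have "continuous_on UNIV (\<lambda>p :: (real^'n^'m) \<times> (real^'n). fst p *v snd p)"
    unfolding matrix_vector_mult_def by (intro continuous_intros continuous_on_vec_lambda)
  from borel_measurable_continuous_onI[OF this]
  have "(\<lambda>p :: (real^'n^'m) \<times> (real^'n). fst p *v snd p) \<in> borel_measurable (borel \<Otimes>\<^sub>M borel)"
    by (simp add: borel_prod)
  from measurable_compose[OF measurable_Pair[OF assms] this] show ?thesis by simp
qed

text \<open>Lets expectations pass inside the form, so that only mean matrices remain.\<close>

lemma bounded_linear_matrix_form:
  fixes u :: "real^'m" and v :: "real^'n"
  shows "bounded_linear (\<lambda>B. u \<bullet> (B *v v))"
  unfolding linear_conv_bounded_linear[symmetric]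
  by (intro linearI)
    (simp_all add: matrix_vector_mult_add_rdistrib inner_add_right flip: scaleR_matrix_vector_assoc)

text \<open>\<open>Au\<close> and \<open>Au'\<close> stand for the images of the errors under
  \<open>transpose A\<close>. The product \<open>u \<bullet> u'\<close> is rewritten through the
  norm of \<open>u + u'\<close>, and \<open>Au \<bullet> Au'\<close> through that of
  \<open>Au - Au'\<close>; with these choices both leftover squares have the sign that allows
  dropping them.\<close>

lemma momentum_inequality:
  fixes u u' :: "'a::euclidean_space" and Au Au' :: "'b::euclidean_space"
  assumes "0 \<le> \<omega>" "0 \<le> \<kappa>"
    and low: "s * (norm u)\<^sup>2 \<le> (norm Au)\<^sup>2" and upp: "(norm Au')\<^sup>2 \<le> S * (norm u')\<^sup>2"
  shows "(norm ((1 + \<omega>) *\<^sub>R u - \<omega> *\<^sub>R u'))\<^sup>2 - 2 * \<kappa> * (((1 + \<omega>) *\<^sub>R Au - \<omega> *\<^sub>R Au') \<bullet> Au)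
    \<le> (1 + 3 * \<omega> + 2 * \<omega>\<^sup>2 - (2 * \<kappa> + \<kappa> * \<omega>) * s) * (norm u)\<^sup>2
      + (2 * \<omega>\<^sup>2 + \<omega> + \<omega> * \<kappa> * S) * (norm u')\<^sup>2"
proof -
  have "(norm ((1 + \<omega>) *\<^sub>R u - \<omega> *\<^sub>R u'))\<^sup>2
      = (1 + 3 * \<omega> + 2 * \<omega>\<^sup>2) * (norm u)\<^sup>2 + (2 * \<omega>\<^sup>2 + \<omega>) * (norm u')\<^sup>2
        - (\<omega> + \<omega>\<^sup>2) * (norm (u + u'))\<^sup>2"
    unfolding power2_norm_eq_inner
    by (simp add: inner_simps inner_commute algebra_simps power2_eq_square)
  also have "\<dots> \<le> (1 + 3 * \<omega> + 2 * \<omega>\<^sup>2) * (norm u)\<^sup>2 + (2 * \<omega>\<^sup>2 + \<omega>) * (norm u')\<^sup>2"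
    using assms(1) by simp
  finally have 1: "(norm ((1 + \<omega>) *\<^sub>R u - \<omega> *\<^sub>R u'))\<^sup>2
    \<le> (1 + 3 * \<omega> + 2 * \<omega>\<^sup>2) * (norm u)\<^sup>2 + (2 * \<omega>\<^sup>2 + \<omega>) * (norm u')\<^sup>2" .
  have "2 * (((1 + \<omega>) *\<^sub>R Au - \<omega> *\<^sub>R Au') \<bullet> Au)
      = (2 + \<omega>) * (norm Au)\<^sup>2 - \<omega> * (norm Au')\<^sup>2 + \<omega> * (norm (Au - Au'))\<^sup>2"
    unfolding power2_norm_eq_inner
    by (simp add: inner_simps inner_commute algebra_simps)
  also have "\<dots> \<ge> (2 + \<omega>) * (s * (norm u)\<^sup>2) - \<omega> * (S * (norm u')\<^sup>2)"
  proof -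
    have "(2 + \<omega>) * (s * (norm u)\<^sup>2) \<le> (2 + \<omega>) * (norm Au)\<^sup>2"
      using assms(1) low by (intro mult_left_mono) auto
    moreover have "\<omega> * (norm Au')\<^sup>2 \<le> \<omega> * (S * (norm u')\<^sup>2)"
      using assms(1) upp by (intro mult_left_mono)
    moreover have "0 \<le> \<omega> * (norm (Au - Au'))\<^sup>2" using assms(1) by simp
    ultimately show ?thesis by linarith
  qed
  finally have "\<kappa> * ((2 + \<omega>) * (s * (norm u)\<^sup>2) - \<omega> * (S * (norm u')\<^sup>2))
      \<le> \<kappa> * (2 * (((1 + \<omega>) *\<^sub>R Au - \<omega> *\<^sub>R Au') \<bullet> Au))"
    using assms(2) by (intro mult_left_mono)
  with 1 show ?thesis by (simp add: algebra_simps)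
qed

text \<open>Here \<open>u\<close> and \<open>u'\<close> are fixed, as the current and previous
  errors are when conditioning on the past. The first claim turns the inner nonnegative integral of
  the Tonelli identity into a finite expectation, which the second one bounds.\<close>

lemma mpfr_step_second_moment:
  fixes A :: "real^'n^'m" and D :: "('m, 'n) quadruple measure" and u u' :: "real^'m"
  assumes D: "prob_space D" "sets D = sets quadruple_space"
    and int: "integrable D (mpfr_matrix A)" "integrable D (mpfr_gram A)"
    and mean: "(\<integral>Z. mpfr_matrix A Z \<partial>D) = c *\<^sub>R transpose A"
    and \<alpha>: "0 \<le> \<alpha>" and c: "0 \<le> c" and \<omega>: "0 \<le> \<omega>"
    and u: "u \<in> range ((*v) A)" "u' \<in> range ((*v) A)"
  defines "\<beta> \<equiv> spectral_norm (\<integral>Z. mpfr_gram A Z \<partial>D)"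
  shows "(\<integral>\<^sup>+Z. ennreal ((norm (u - \<alpha> *\<^sub>R (A *v (mpfr_matrix A Z *v u)) + \<omega> *\<^sub>R (u - u')))\<^sup>2) \<partial>D)
      = ennreal (\<integral>Z. (norm (u - \<alpha> *\<^sub>R (A *v (mpfr_matrix A Z *v u)) + \<omega> *\<^sub>R (u - u')))\<^sup>2 \<partial>D)"
    and "(\<integral>Z. (norm (u - \<alpha> *\<^sub>R (A *v (mpfr_matrix A Z *v u)) + \<omega> *\<^sub>R (u - u')))\<^sup>2 \<partial>D)
      \<le> (1 + 3 * \<omega> + 2 * \<omega>\<^sup>2 - (2 * \<alpha> + \<alpha> * \<omega>) * (c * (sigma_min A)\<^sup>2) + \<alpha>\<^sup>2 * \<beta>) * (norm u)\<^sup>2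
        + (2 * \<omega>\<^sup>2 + \<omega> + \<omega> * \<alpha> * (c * (sigma_max A)\<^sup>2)) * (norm u')\<^sup>2"
proof -
  interpret D: prob_space D by fact
  \<comment> \<open>The deterministic part of the step, \<open>u + \<omega> (u - u')\<close>; what
    remains is linear in the sampled matrix.\<close>
  define p where "p = (1 + \<omega>) *\<^sub>R u - \<omega> *\<^sub>R u'"
  let ?g = "\<lambda>Z. (norm p)\<^sup>2 - 2 * \<alpha> * ((transpose A *v p) \<bullet> (mpfr_matrix A Z *v u))
    + \<alpha>\<^sup>2 * (u \<bullet> (mpfr_gram A Z *v u))"
  let ?f = "\<lambda>Z. (norm (u - \<alpha> *\<^sub>R (A *v (mpfr_matrix A Z *v u)) + \<omega> *\<^sub>R (u - u')))\<^sup>2"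
  have f: "?f Z = ?g Z" if "Z \<in> space D" for Z
  proof -
    let ?N = "A *v (mpfr_matrix A Z *v u)"
    have "Z \<in> space quadruple_space" using that D(2) sets_eq_imp_space_eq by blast
    note gram = inner_mpfr_gram[OF this, of u A]
    have "u - \<alpha> *\<^sub>R ?N + \<omega> *\<^sub>R (u - u') = p - \<alpha> *\<^sub>R ?N" by (simp add: p_def algebra_simps)
    then have "?f Z = (norm p)\<^sup>2 - 2 * \<alpha> * (p \<bullet> ?N) + \<alpha>\<^sup>2 * (norm ?N)\<^sup>2"
      unfolding power2_norm_eq_inner
      by (simp add: inner_simps inner_commute algebra_simps power2_eq_square)
    moreover have "p \<bullet> ?N = (transpose A *v p) \<bullet> (mpfr_matrix A Z *v u)"
      using inner_transpose_vector[of "mpfr_matrix A Z *v u" A p] by (simp add: inner_commute)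
    ultimately show ?thesis using gram by simp
  qed
  note int1 = integrable_bounded_linear[OF bounded_linear_matrix_form int(1), of "transpose A *v p" u]
  note int2 = integrable_bounded_linear[OF bounded_linear_matrix_form int(2), of u u]
  have intg: "integrable D ?g"
    using int1 int2 by (intro Bochner_Integration.integrable_add Bochner_Integration.integrable_diff
        integrable_mult_right) auto
  then have intf: "integrable D ?f" using f by (simp cong: Bochner_Integration.integrable_cong)
  then show "(\<integral>\<^sup>+Z. ennreal (?f Z) \<partial>D) = ennreal (\<integral>Z. ?f Z \<partial>D)"
    by (intro nn_integral_eq_integral) auto
  let ?G = "\<integral>Z. mpfr_gram A Z \<partial>D"
  have "(\<integral>Z. ?f Z \<partial>D) = (\<integral>Z. ?g Z \<partial>D)" using f by (intro Bochner_Integration.integral_cong) auto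
  also have "\<dots> = (norm p)\<^sup>2 - 2 * \<alpha> * ((transpose A *v p) \<bullet> ((c *\<^sub>R transpose A) *v u))
      + \<alpha>\<^sup>2 * (u \<bullet> (?G *v u))"
    using int1 int2
      integral_bounded_linear[OF bounded_linear_matrix_form int(1), of "transpose A *v p" u]
      integral_bounded_linear[OF bounded_linear_matrix_form int(2), of u u]
    by (simp add: mean D.prob_space)
  also have "\<dots> = (norm p)\<^sup>2 - 2 * (\<alpha> * c) * (((1 + \<omega>) *\<^sub>R (transpose A *v u) - \<omega> *\<^sub>R (transpose A *v u'))
      \<bullet> (transpose A *v u)) + \<alpha>\<^sup>2 * (u \<bullet> (?G *v u))"
    by (simp add: p_def matrix_vector_mult_diff_distrib matrix_vector_mult_scaleR
        del: transpose_matrix_vector flip: scaleR_matrix_vector_assoc)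
  finally have eq: "(\<integral>Z. ?f Z \<partial>D) = (norm p)\<^sup>2 - 2 * (\<alpha> * c) * (((1 + \<omega>) *\<^sub>R (transpose A *v u)
      - \<omega> *\<^sub>R (transpose A *v u')) \<bullet> (transpose A *v u)) + \<alpha>\<^sup>2 * (u \<bullet> (?G *v u))" .
  have "u \<bullet> (?G *v u) \<le> norm u * norm (?G *v u)" by (rule norm_cauchy_schwarz)
  also have "\<dots> \<le> norm u * (\<beta> * norm u)"
    unfolding \<beta>_def by (intro mult_left_mono onorm) auto
  finally have "u \<bullet> (?G *v u) \<le> \<beta> * (norm u)\<^sup>2" by (simp add: power2_eq_square algebra_simps)
  then have "\<alpha>\<^sup>2 * (u \<bullet> (?G *v u)) \<le> \<alpha>\<^sup>2 * (\<beta> * (norm u)\<^sup>2)" by (intro mult_left_mono) auto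
  moreover note momentum_inequality[OF \<omega> mult_nonneg_nonneg[OF \<alpha> c]
      sigma_min_le_on_range[OF u(1)] sigma_max_ge_on_range[OF u(2)], folded p_def]
  ultimately show "(\<integral>Z. ?f Z \<partial>D)
      \<le> (1 + 3 * \<omega> + 2 * \<omega>\<^sup>2 - (2 * \<alpha> + \<alpha> * \<omega>) * (c * (sigma_min A)\<^sup>2) + \<alpha>\<^sup>2 * \<beta>) * (norm u)\<^sup>2
        + (2 * \<omega>\<^sup>2 + \<omega> + \<omega> * \<alpha> * (c * (sigma_max A)\<^sup>2)) * (norm u')\<^sup>2"
    unfolding eq by (simp add: algebra_simps)
qed

section \<open>Convergence of the expected squared residual error\<close>

theorem theorem4p10:
  fixes A :: "real^'n^'m" and b :: "real^'m"
    and D :: "('m, 'n) quadruple measure"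
    and M :: "'w measure" and Q :: "nat \<Rightarrow> 'w \<Rightarrow> ('m, 'n) quadruple"
    and x\<^sub>0 x\<^sub>L\<^sub>S :: "real^'n" and x :: "nat \<Rightarrow> 'w \<Rightarrow> real^'n"
    and r\<^sub>s :: "real^'m" and r :: "nat \<Rightarrow> 'w \<Rightarrow> real^'m"
    and \<alpha> \<omega> \<beta> \<gamma>\<^sub>1 \<gamma>\<^sub>2 q \<tau> :: real
  assumes A_nonzero: "A \<noteq> 0"
    and D_prob: "prob_space D" and D_sets: "sets D = sets quadruple_space"
    and D_integrable: "integrable D (mpfr_matrix A)"
    and D_mean: "(\<integral>Z. mpfr_matrix A Z \<partial>D) = (1 / (frobenius_norm A)\<^sup>2) *\<^sub>R transpose A"
    and gram_integrable: "integrable D (mpfr_gram A)"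
    and M_prob: "prob_space M"
    and Q_indep: "prob_space.indep_vars M (\<lambda>_. quadruple_space) Q {1..}"
    and Q_distr: "\<And>k. k \<ge> 1 \<Longrightarrow> distr M quadruple_space (Q k) = D"
    and x_LS: "x\<^sub>L\<^sub>S = pseudoinverse A *v b"
    and x_init: "\<And>w. w \<in> space M \<Longrightarrow> x 0 w = x\<^sub>0" "\<And>w. w \<in> space M \<Longrightarrow> x 1 w = x\<^sub>0"
    and x_step: "\<And>k w. k \<ge> 1 \<Longrightarrow> w \<in> space M \<Longrightarrow>
      x (k + 1) w = x k w - \<alpha> *\<^sub>R (mpfr_matrix A (Q k w) *v (A *v x k w - b))
        + \<omega> *\<^sub>R (x k w - x (k - 1) w)"
    and r_s: "r\<^sub>s = A *v x\<^sub>L\<^sub>S - b"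
    and r_k: "\<And>k w. r k w = A *v x k w - b"
    and beta: "\<beta> = spectral_norm (\<integral>Z. mpfr_gram A Z \<partial>D)"
    and r_s_kernel: "AE Z in D. mpfr_matrix A Z *v r\<^sub>s = 0"
    and alpha: "0 < \<alpha>" "\<alpha> < 2 * (sigma_min A)\<^sup>2 / (\<beta> * (frobenius_norm A)\<^sup>2)"
    and omega: "\<omega> \<ge> 0"
    and gamma1: "\<gamma>\<^sub>1 = 1 + 3 * \<omega> + 2 * \<omega>\<^sup>2
      - (2 * \<alpha> + \<alpha> * \<omega>) * ((sigma_min A)\<^sup>2 / (frobenius_norm A)\<^sup>2) + \<alpha>\<^sup>2 * \<beta>"
    and gamma2: "\<gamma>\<^sub>2 = 2 * \<omega>\<^sup>2 + \<omega> + \<omega> * \<alpha> * ((sigma_max A)\<^sup>2 / (frobenius_norm A)\<^sup>2)"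
    and gamma_sum: "\<gamma>\<^sub>1 + \<gamma>\<^sub>2 < 1"
    and q: "q = (if \<omega> > 0 then (\<gamma>\<^sub>1 + sqrt (\<gamma>\<^sub>1\<^sup>2 + 4 * \<gamma>\<^sub>2)) / 2 else \<gamma>\<^sub>1)"
    and tau: "\<tau> = q - \<gamma>\<^sub>1"
  shows "(\<forall>k. integrable M (\<lambda>w. (norm (r (k + 1) w - r\<^sub>s))\<^sup>2) \<and>
      (\<integral>w. (norm (r (k + 1) w - r\<^sub>s))\<^sup>2 \<partial>M)
        \<le> q ^ k * (1 + \<tau>) * (norm ((A *v x\<^sub>0 - b) - r\<^sub>s))\<^sup>2) \<and>
    \<tau> \<ge> 0 \<and> \<gamma>\<^sub>1 + \<gamma>\<^sub>2 \<le> q \<and> q < 1"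
proof -
  interpret M: prob_space M by fact
  let ?N = "quadruple_space :: ('m, 'n) quadruple measure"
  let ?F2 = "(frobenius_norm A)\<^sup>2"
  \<comment> \<open>The error \<open>r k w - r\<^sub>s\<close>, in a form that shows it to lie in
    the range of A, where the singular value bounds hold.\<close>
  define y where "y k w = A *v (x k w - x\<^sub>L\<^sub>S)" for k w
  have y: "r k w - r\<^sub>s = y k w" for k w
    by (simp add: y_def r_k r_s matrix_vector_mult_diff_distrib)
  have y_range: "y k w \<in> range ((*v) A)" for k w by (simp add: y_def)
  \<comment> \<open>The homogeneous error update. It agrees with the actual one where the sampled
    matrix annihilates \<open>r\<^sub>s\<close>, hence almost surely.\<close>
  define step where "step u u' Z = u - \<alpha> *\<^sub>R (A *v (mpfr_matrix A Z *v u)) + \<omega> *\<^sub>R (u - u')" for u u' Z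
  note moment = mpfr_step_second_moment[OF D_prob D_sets D_integrable gram_integrable D_mean
      less_imp_le[OF alpha(1)] _ omega, folded beta step_def]
  have step_eq: "(\<integral>\<^sup>+Z. ennreal ((norm (step u u' Z))\<^sup>2) \<partial>D) = ennreal (\<integral>Z. (norm (step u u' Z))\<^sup>2 \<partial>D)"
    and step_le: "(\<integral>Z. (norm (step u u' Z))\<^sup>2 \<partial>D) \<le> \<gamma>\<^sub>1 * (norm u)\<^sup>2 + \<gamma>\<^sub>2 * (norm u')\<^sup>2"
    if "u \<in> range ((*v) A)" "u' \<in> range ((*v) A)" for u u'
    using moment[OF _ that] by (simp_all add: gamma1 gamma2)
  have \<gamma>2: "0 \<le> \<gamma>\<^sub>2" using omega alpha(1) by (simp add: gamma2)
  \<comment> \<open>The bound on the nonnegative second moment at a nonzero u with \<open>u' = 0\<close> forces the sign of \<open>\<gamma>\<^sub>1\<close>.\<close>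
  have \<gamma>1: "0 \<le> \<gamma>\<^sub>1"
  proof -
    obtain v where v: "A *v v \<noteq> 0"
      using A_nonzero by (metis matrix_eq matrix_vector_mult_0)
    have "0 \<le> (\<integral>Z. (norm (step (A *v v) 0 Z))\<^sup>2 \<partial>D)" by simp
    also have "\<dots> \<le> \<gamma>\<^sub>1 * (norm (A *v v))\<^sup>2"
      using step_le[of "A *v v" 0] by (simp add: image_iff) (metis matrix_vector_mult_0_right)
    finally show ?thesis using v by (simp add: zero_le_mult_iff)
  qed
  have W[measurable]: "mpfr_matrix A \<in> borel_measurable ?N"
    using borel_measurable_integrable[OF D_integrable] D_sets by (simp cong: measurable_cong_sets)
  let ?L = "borel :: ((real^'n) \<times> (real^'n)) measure"
  \<comment> \<open>Momentum makes the iteration second order; the pair of the current and previous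
    iterates obeys a first-order recursion, started at k = 1.\<close>
  define g where "g p Z = (fst p - \<alpha> *\<^sub>R (mpfr_matrix A Z *v (A *v fst p - b)) + \<omega> *\<^sub>R (fst p - snd p), fst p)"
    for p :: "(real^'n) \<times> (real^'n)" and Z
  have g: "(\<lambda>(p, Z). g p Z) \<in> measurable (?L \<Otimes>\<^sub>M ?N) ?L"
    unfolding g_def borel_prod[symmetric] case_prod_beta
    by measurable
  have P1: "(x 1 w, x (1 - 1) w) = (x\<^sub>0, x\<^sub>0)" if "w \<in> space M" for w
    using x_init[OF that] by simp
  have P_step: "(x (Suc k) w, x (Suc k - 1) w) = g (x k w, x (k - 1) w) (Q k w)"
    if "k \<ge> 1" "w \<in> space M" for k w
    using x_step[OF that] by (simp add: g_def)
  have P_space: "(x\<^sub>0, x\<^sub>0) \<in> space ?L" by simp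
  note state = M.random_recursion_independent_input[where P = "\<lambda>k w. (x k w, x (k - 1) w)",
      OF Q_indep g P_space]
  have x_pair: "(\<lambda>w. (x k w, x (k - 1) w)) \<in> measurable M ?L" if "k \<ge> 1" for k
    by (rule state(1); (rule that | erule P1 | erule (1) P_step))
  have independent:
    "(\<integral>\<^sup>+w. f ((x k w, x (k - 1) w), Q k w) \<partial>M) = (\<integral>\<^sup>+w. (\<integral>\<^sup>+Z. f ((x k w, x (k - 1) w), Z) \<partial>D) \<partial>M)"
    if "k \<ge> 1" and f: "f \<in> borel_measurable (?L \<Otimes>\<^sub>M ?N)" for k f
    unfolding Q_distr[OF that(1), symmetric]
    by (rule state(2); (rule that | erule P1 | erule (1) P_step))
  have x_meas[measurable]: "x k \<in> borel_measurable M" for k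
  proof -
    have "(\<lambda>w. (x (Suc k) w, x (Suc k - 1) w)) \<in> measurable M (borel \<Otimes>\<^sub>M borel)"
      using x_pair[of "Suc k"] by (simp add: borel_prod)
    from measurable_snd'[OF this] show ?thesis by simp
  qed
  have y_meas[measurable]: "y k \<in> borel_measurable M" for k
    unfolding y_def by measurable
  have kernel: "AE w in M. mpfr_matrix A (Q k w) *v r\<^sub>s = 0" if "k \<ge> 1" for k
  proof -
    have "Q k \<in> measurable M ?N" using Q_indep that by (simp add: M.indep_vars_def)
    then show ?thesis by (rule AE_distrD) (unfold Q_distr[OF that], fact r_s_kernel)
  qed
  have bound: "(\<integral>\<^sup>+w. ennreal ((norm (y (k + 1) w))\<^sup>2) \<partial>M)
      \<le> (\<integral>\<^sup>+w. ennreal (\<gamma>\<^sub>1 * (norm (y k w))\<^sup>2 + \<gamma>\<^sub>2 * (norm (y (k - 1) w))\<^sup>2) \<partial>M)" if k: "k \<ge> 1" for k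
  proof -
    let ?f = "\<lambda>(p, Z). ennreal ((norm (step (A *v (fst p - x\<^sub>L\<^sub>S)) (A *v (snd p - x\<^sub>L\<^sub>S)) Z))\<^sup>2)"
    have f: "?f \<in> borel_measurable (?L \<Otimes>\<^sub>M ?N)"
      unfolding step_def borel_prod[symmetric] case_prod_beta
      by measurable
    have "AE w in M. y (k + 1) w = step (y k w) (y (k - 1) w) (Q k w)"
      using kernel[OF k] AE_space
    proof eventually_elim
      case (elim w)
      have "A *v x k w - b = y k w + r\<^sub>s"
        by (simp add: y_def r_s matrix_vector_mult_diff_distrib)
      then have "x (k + 1) w - x\<^sub>L\<^sub>S = (x k w - x\<^sub>L\<^sub>S) - \<alpha> *\<^sub>R (mpfr_matrix A (Q k w) *v y k w)
          + \<omega> *\<^sub>R ((x k w - x\<^sub>L\<^sub>S) - (x (k - 1) w - x\<^sub>L\<^sub>S))"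
        using x_step[OF k elim(2)] elim(1) by (simp add: matrix_vector_right_distrib)
      then show ?case
        by (simp add: y_def step_def matrix_vector_right_distrib matrix_vector_mult_diff_distrib
            matrix_vector_mult_scaleR)
    qed
    then have "(\<integral>\<^sup>+w. ennreal ((norm (y (k + 1) w))\<^sup>2) \<partial>M)
        = (\<integral>\<^sup>+w. ?f ((x k w, x (k - 1) w), Q k w) \<partial>M)"
      by (intro nn_integral_cong_AE) (auto simp: y_def)
    also have "\<dots> = (\<integral>\<^sup>+w. (\<integral>\<^sup>+Z. ?f ((x k w, x (k - 1) w), Z) \<partial>D) \<partial>M)"
      using independent[OF k f] .
    also have "\<dots> \<le> (\<integral>\<^sup>+w. ennreal (\<gamma>\<^sub>1 * (norm (y k w))\<^sup>2 + \<gamma>\<^sub>2 * (norm (y (k - 1) w))\<^sup>2) \<partial>M)"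
      using step_eq[OF y_range y_range] step_le[OF y_range y_range]
      by (intro nn_integral_mono) (auto simp flip: y_def intro!: ennreal_leI)
    finally show ?thesis .
  qed
  have y_init: "y 0 w = A *v (x\<^sub>0 - x\<^sub>L\<^sub>S)" "y (Suc 0) w = A *v (x\<^sub>0 - x\<^sub>L\<^sub>S)" if "w \<in> space M" for w
    using x_init[OF that] by (simp_all add: y_def)
  \<comment> \<open>Integrability at two consecutive times makes the right-hand side of
    \<open>bound\<close> finite, which gives it at the next time; hence the induction over
    pairs.\<close>
  have int: "integrable M (\<lambda>w. (norm (y k w))\<^sup>2) \<and> integrable M (\<lambda>w. (norm (y (Suc k) w))\<^sup>2)" for k
  proof (induction k)
    case 0
    show ?case using y_init by (simp cong: Bochner_Integration.integrable_cong)
  next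
    case (Suc k)
    have "integrable M (\<lambda>w. \<gamma>\<^sub>1 * (norm (y (Suc k) w))\<^sup>2 + \<gamma>\<^sub>2 * (norm (y k w))\<^sup>2)"
      using Suc by simp
    then have "(\<integral>\<^sup>+w. ennreal (\<gamma>\<^sub>1 * (norm (y (Suc k) w))\<^sup>2 + \<gamma>\<^sub>2 * (norm (y k w))\<^sup>2) \<partial>M) < \<infinity>"
      using \<gamma>1 \<gamma>2 by (subst nn_integral_eq_integral) auto
    with bound[of "Suc k"] have "(\<integral>\<^sup>+w. ennreal ((norm (y (Suc (Suc k)) w))\<^sup>2) \<partial>M) < \<infinity>"
      by (simp add: order_le_less_trans)
    then have "integrable M (\<lambda>w. (norm (y (Suc (Suc k)) w))\<^sup>2)"
      by (intro integrableI_bounded) auto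
    with Suc show ?case by simp
  qed
  define F where "F k = (\<integral>w. (norm (y k w))\<^sup>2 \<partial>M)" for k
  have rec: "F (k + 2) \<le> \<gamma>\<^sub>1 * F (k + 1) + \<gamma>\<^sub>2 * F k" for k
  proof -
    have "ennreal (F (k + 2)) = (\<integral>\<^sup>+w. ennreal ((norm (y (Suc k + 1) w))\<^sup>2) \<partial>M)"
      using int[of "Suc k"] by (simp add: F_def nn_integral_eq_integral)
    also have "\<dots> \<le> (\<integral>\<^sup>+w. ennreal (\<gamma>\<^sub>1 * (norm (y (Suc k) w))\<^sup>2 + \<gamma>\<^sub>2 * (norm (y k w))\<^sup>2) \<partial>M)"
      using bound[of "Suc k"] by simp
    also have "\<dots> = ennreal (\<integral>w. \<gamma>\<^sub>1 * (norm (y (Suc k) w))\<^sup>2 + \<gamma>\<^sub>2 * (norm (y k w))\<^sup>2 \<partial>M)"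
      using int[of k] \<gamma>1 \<gamma>2 by (intro nn_integral_eq_integral) auto
    also have "(\<integral>w. \<gamma>\<^sub>1 * (norm (y (Suc k) w))\<^sup>2 + \<gamma>\<^sub>2 * (norm (y k w))\<^sup>2 \<partial>M) = \<gamma>\<^sub>1 * F (k + 1) + \<gamma>\<^sub>2 * F k"
      using int[of k] by (simp add: F_def)
    finally show ?thesis
      by (rule ennreal_le_iff[THEN iffD1, rotated]) (simp add: F_def \<gamma>1 \<gamma>2)
  qed
  have F0: "F 0 = (norm ((A *v x\<^sub>0 - b) - r\<^sub>s))\<^sup>2" "F 1 = F 0"
    using y_init by (simp_all add: F_def r_s matrix_vector_mult_diff_distrib M.prob_space
        cong: Bochner_Integration.integral_cong)
  have root: "q = (\<gamma>\<^sub>1 + sqrt (\<gamma>\<^sub>1\<^sup>2 + 4 * \<gamma>\<^sub>2)) / 2"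
    using q omega \<gamma>1 by (cases "\<omega> > 0") (auto simp: gamma2)
  note root = momentum_root[OF \<gamma>1 \<gamma>2 gamma_sum root]
  have "F (k + 1) \<le> q ^ k * (1 + \<tau>) * F 0" for k
    using root by (intro momentum_recurrence_bound[OF rec _ F0(2)]) (auto simp: tau F_def)
  then show ?thesis
    using root int F0(1) by (simp add: y tau F_def)
qed

end
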